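(* Let $K \ge 2$ be an integer and let $0<b<a<1$. Let $\boldsymbol{B} \in (0,1)^{K\times K}$ be the matrix with $\boldsymbol{B}_{ij}=a$ for $i=j$ and $\boldsymbol{B}_{ij}=b$ for $i\neq j$, and let $\boldsymbol{\pi}=(\tfrac1K,\dots,\tfrac1K)\in\mathbb{R}^K$. Then the ratio $\rho^{\star}=\rho^{\star}(\boldsymbol{B},\boldsymbol{\pi})$ is given by $$\rho^{\star} = 1 + \frac{(a-b)^{2}\bigl(3a(a-1)+3b(b-1)(K-1)+4abK\bigr)}{4(a+(K-1)b)^{2}\bigl(a(1-a)+b(1-b)\bigr)} = 1 + c_{a,b,K}\,\psi_{a,b,K},$$ where $\psi_{a,b,K} := 3a(a-1)+3b(b-1)(K-1)+4abK$ and $c_{a,b,K} := \dfrac{(a-b)^{2}}{4(a+(K-1)b)^{2}(a(1-a)+b(1-b))} > 0$.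
   Context: Definition of $\rho^\star(\boldsymbol{B},\boldsymbol{\pi})$ for the stochastic block model considered here. The symmetric matrix $\boldsymbol{B}$ is positive definite, so write $\boldsymbol{B}=\boldsymbol{X}\boldsymbol{X}^\top$ with $\boldsymbol{X}\in\mathbb{R}^{K\times K}$ the Cholesky factor (lower triangular with positive diagonal entries), and let the latent positions $\nu_1,\dots,\nu_K\in\mathbb{R}^K$ be the rows of $\boldsymbol{X}$ (as column vectors); thus $\langle \nu_k,\nu_l\rangle=\boldsymbol{B}_{kl}$ for the standard Euclidean inner product. Let $X_1$ be a random vector with $\mathbb{P}[X_1=\nu_k]=\pi_k$ for $k=1,\dots,K$. Put $\mu:=\mathbb{E}[X_1]$, $\boldsymbol{\Delta}:=\mathbb{E}[X_1X_1^\top]$, $\tilde{\boldsymbol{\Delta}}:=\mathbb{E}\bigl[\langle \mu,X_1\rangle^{-1}X_1X_1^\top\bigr]$, and $g(x,y):=\langle x,y\rangle(1-\langle x,y\rangle)$. For $x\in\{\nu_1,\dots,\nu_K\}$ define $$\boldsymbol{\Sigma}(x):=\boldsymbol{\Delta}^{-1}\,\mathbb{E}\bigl[g(x,X_1)X_1X_1^\top\bigr]\,\boldsymbol{\Delta}^{-1},$$ $$\tilde{\boldsymbol{\Sigma}}(x):=\tilde{\boldsymbol{\Delta}}^{-1}\,\mathbb{E}\left[\frac{g(x,X_1)}{\langle\mu,x\rangle}\left(\frac{X_1}{\langle\mu,X_1\rangle}-\frac{\tilde{\boldsymbol{\Delta}}x}{2\langle\mu,x\rangle}\right)\left(\frac{X_1}{\langle\mu,X_1\rangle}-\frac{\tilde{\boldsymbol{\Delta}}x}{2\langle\mu,x\rangle}\right)^{\top}\right]\tilde{\boldsymbol{\Delta}}^{-1}.$$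 (These are the block-conditional limiting covariance matrices of the adjacency and Laplacian spectral embeddings.) For $k\ne l$ and $t\in(0,1)$ let $\boldsymbol{\Sigma}_{kl}(t):=t\boldsymbol{\Sigma}(\nu_k)+(1-t)\boldsymbol{\Sigma}(\nu_l)$ and $\tilde{\boldsymbol{\Sigma}}_{kl}(t):=t\tilde{\boldsymbol{\Sigma}}(\nu_k)+(1-t)\tilde{\boldsymbol{\Sigma}}(\nu_l)$, and let $\tilde{\nu}_k:=\nu_k/\bigl(\sum_{k'}\pi_{k'}\langle\nu_{k'},\nu_k\rangle\bigr)^{1/2}$. For a symmetric positive definite matrix $\boldsymbol{M}$ write $\|v\|_{\boldsymbol{M}}^2:=v^\top\boldsymbol{M}v$. Then $$\rho^\star:=\frac{\min_{k\neq l}\ \sup_{t\in(0,1)}\bigl[t(1-t)\,\|\nu_k-\nu_l\|^2_{\boldsymbol{\Sigma}_{kl}(t)^{-1}}\bigr]}{\min_{k\neq l}\ \sup_{t\in(0,1)}\bigl[t(1-t)\,\|\tilde{\nu}_k-\tilde{\nu}_l\|^2_{\tilde{\boldsymbol{\Sigma}}_{kl}(t)^{-1}}\bigr]}.$$ *)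

theory Defs
  imports "HOL-Probability.Probability"
begin

text \<open>
  The blocks are the elements of a finite linearly ordered type \<open>'k\<close>, so that \<open>K = CARD('k)\<close>;
  the order is what makes ``lower triangular'' meaningful. The block probabilities are a pmf
  on \<open>'k\<close>.
\<close>

type_synonym 'k rvec = "(real, 'k) vec"
type_synonym 'k sqmat = "((real, 'k) vec, 'k) vec"

definition is_cholesky_factor :: "('k::{finite,linorder}) sqmat \<Rightarrow> 'k sqmat \<Rightarrow> bool" where
  "is_cholesky_factor B X \<longleftrightarrow>
     (\<forall>i j. i < j \<longrightarrow> X $ i $ j = 0) \<and> (\<forall>i. 0 < X $ i $ i) \<and> B = X ** transpose X"

text \<open>For symmetric positive definite \<open>B\<close> there is exactly one such factor.\<close>

definition cholesky_factor :: "('k::{finite,linorder}) sqmat \<Rightarrow> 'k sqmat" where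
  "cholesky_factor B = (THE X. is_cholesky_factor B X)"

definition outer_prod :: "('n::finite) rvec \<Rightarrow> 'n rvec \<Rightarrow> 'n sqmat" where
  "outer_prod x y = (\<chi> i j. x $ i * y $ j)"

definition sq_norm_wrt :: "('n::finite) sqmat \<Rightarrow> 'n rvec \<Rightarrow> real" where
  "sq_norm_wrt M v = v \<bullet> (M *v v)"

definition bern_var :: "('n::finite) rvec \<Rightarrow> 'n rvec \<Rightarrow> real" where
  "bern_var x y = (x \<bullet> y) * (1 - x \<bullet> y)"

definition latent_pos :: "'k sqmat \<Rightarrow> 'k \<Rightarrow> ('k::{finite,linorder}) rvec" where
  "latent_pos B k = row k (cholesky_factor B)"

text \<open>The law of \<open>X\<^sub>1\<close>; the expectations below are integrals over it.\<close>

definition latent_pmf :: "'k sqmat \<Rightarrow> 'k pmf \<Rightarrow> ('k::{finite,linorder}) rvec pmf" where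
  "latent_pmf B \<pi> = map_pmf (latent_pos B) \<pi>"

definition latent_mean :: "('n::finite) rvec pmf \<Rightarrow> 'n rvec" where
  "latent_mean F = measure_pmf.expectation F (\<lambda>y. y)"

definition Delta :: "('n::finite) rvec pmf \<Rightarrow> 'n sqmat" where
  "Delta F = measure_pmf.expectation F (\<lambda>y. outer_prod y y)"

definition Delta_tilde :: "('n::finite) rvec pmf \<Rightarrow> 'n sqmat" where
  "Delta_tilde F =
     measure_pmf.expectation F (\<lambda>y. inverse (latent_mean F \<bullet> y) *\<^sub>R outer_prod y y)"

definition Sigma_ASE :: "('n::finite) rvec pmf \<Rightarrow> 'n rvec \<Rightarrow> 'n sqmat" where
  "Sigma_ASE F x =
     matrix_inv (Delta F)
     ** measure_pmf.expectation F (\<lambda>y. bern_var x y *\<^sub>R outer_prod y y)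
     ** matrix_inv (Delta F)"

definition Sigma_LSE :: "('n::finite) rvec pmf \<Rightarrow> 'n rvec \<Rightarrow> 'n sqmat" where
  "Sigma_LSE F x =
     (let \<mu> = latent_mean F;
          w = (\<lambda>y. (1 / (\<mu> \<bullet> y)) *\<^sub>R y - (1 / (2 * (\<mu> \<bullet> x))) *\<^sub>R (Delta_tilde F *v x))
      in matrix_inv (Delta_tilde F)
         ** measure_pmf.expectation F
              (\<lambda>y. (bern_var x y / (\<mu> \<bullet> x)) *\<^sub>R outer_prod (w y) (w y))
         ** matrix_inv (Delta_tilde F))"

definition latent_pos_tilde ::
    "'k sqmat \<Rightarrow> 'k pmf \<Rightarrow> 'k \<Rightarrow> ('k::{finite,linorder}) rvec" where
  "latent_pos_tilde B \<pi> k =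
     (1 / sqrt (\<Sum>k'\<in>UNIV. pmf \<pi> k' * (latent_pos B k' \<bullet> latent_pos B k))) *\<^sub>R latent_pos B k"

text \<open>
  \<open>m k\<close> and \<open>S k\<close> are the limiting mean and covariance attached to block \<open>k\<close>. The minimum is over
  a finite set, which is nonempty as soon as there are at least two blocks.
\<close>

definition min_chernoff :: "('k::finite \<Rightarrow> ('n::finite) rvec) \<Rightarrow> ('k \<Rightarrow> 'n sqmat) \<Rightarrow> real" where
  "min_chernoff m S =
     Min {SUP t\<in>{0<..<1}.
            t * (1 - t) * sq_norm_wrt (matrix_inv (t *\<^sub>R S k + (1 - t) *\<^sub>R S l)) (m k - m l)
          | k l. k \<noteq> l}"

definition rho_star :: "'k sqmat \<Rightarrow> ('k::{finite,linorder}) pmf \<Rightarrow> real" where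
  "rho_star B \<pi> =
     min_chernoff (latent_pos B) (\<lambda>k. Sigma_ASE (latent_pmf B \<pi>) (latent_pos B k))
     / min_chernoff (latent_pos_tilde B \<pi>) (\<lambda>k. Sigma_LSE (latent_pmf B \<pi>) (latent_pos B k))"

definition psi_abK :: "real \<Rightarrow> real \<Rightarrow> nat \<Rightarrow> real" where
  "psi_abK a b K =
     3 * a * (a - 1) + 3 * b * (b - 1) * (real K - 1) + 4 * a * b * real K"

definition c_abK :: "real \<Rightarrow> real \<Rightarrow> nat \<Rightarrow> real" where
  "c_abK a b K =
     (a - b)\<^sup>2 / (4 * (a + (real K - 1) * b)\<^sup>2 * (a * (1 - a) + b * (1 - b)))"

end

theory Submission
  imports Defs
begin

text \<open>
  For this \<open>B\<close> every \<open>\<nu>\<^sub>k - \<nu>\<^sub>l\<close> is an eigenvector of \<open>\<Delta>\<close>, of its Laplacian analogue (a multiple of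
  \<open>\<Delta>\<close>, because \<open>\<langle>\<mu>, \<nu>\<^sub>k\<rangle>\<close> does not depend on \<open>k\<close>), and of the sum over the two blocks of the
  inner expectations in the covariances. The quantity to be maximised over \<open>t\<close> is concave and
  symmetric about \<open>1/2\<close>, so the supremum is its value at \<open>1/2\<close>, which the eigenvalues determine.
  With \<open>\<alpha> = a(1 - a)\<close>, \<open>\<beta> = b(1 - b)\<close>, \<open>r = (a - b)/(2(a + (K - 1)b))\<close> it is \<open>(a - b)\<^sup>2/(K(\<alpha> + \<beta>))\<close> for
  the adjacency embedding and \<open>(a - b)\<^sup>2/(KL)\<close> for the Laplacian one, where
  \<open>L = \<alpha>(1 - r)\<^sup>2 + \<beta>(1 + r)\<^sup>2 + (K - 2)\<beta>r\<^sup>2\<close>. Hence \<open>\<rho>\<^sup>\<star> = L/(\<alpha> + \<beta>)\<close>.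
\<close>

section \<open>Positive definite matrices and their inverses\<close>

definition pos_def :: "(real, 'n::finite) vec ^ 'n \<Rightarrow> bool" where
  "pos_def A \<longleftrightarrow> (\<forall>x y. x \<bullet> (A *v y) = (A *v x) \<bullet> y) \<and> (\<forall>x. x \<noteq> 0 \<longrightarrow> 0 < x \<bullet> (A *v x))"

lemma pos_def_sym: "pos_def A \<Longrightarrow> x \<bullet> (A *v y) = (A *v x) \<bullet> y"
  by (auto simp: pos_def_def)

lemma pos_def_pos: "pos_def A \<Longrightarrow> x \<noteq> 0 \<Longrightarrow> 0 < x \<bullet> (A *v x)"
  by (auto simp: pos_def_def)

lemma pos_def_nonneg: "pos_def A \<Longrightarrow> 0 \<le> x \<bullet> (A *v x)"
  by (cases "x = 0") (auto dest: pos_def_pos intro: less_imp_le)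

lemma pos_def_invertible:
  assumes "pos_def A"
  shows "invertible A"
proof -
  have "A *v x = 0 \<Longrightarrow> x = 0" for x
    using pos_def_pos[OF assms, of x] by auto
  then show ?thesis
    by (auto simp: invertible_left_inverse matrix_left_invertible_ker)
qed

lemma matrix_inv_mult_vec:
  fixes A :: "(real, 'n::finite) vec ^ 'n"
  assumes "invertible A"
  shows "A *v (matrix_inv A *v x) = x" and "matrix_inv A *v (A *v x) = x"
proof -
  have "A ** matrix_inv A = mat 1 \<and> matrix_inv A ** A = mat 1"
    using assms unfolding invertible_def matrix_inv_def by (rule someI_ex)
  then show "A *v (matrix_inv A *v x) = x" "matrix_inv A *v (A *v x) = x"
    by (simp_all add: matrix_vector_mul_assoc)
qed

lemma pos_def_matrix_inv_sym:
  assumes "pos_def A"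
  shows "x \<bullet> (matrix_inv A *v y) = (matrix_inv A *v x) \<bullet> y"
proof -
  note inv = matrix_inv_mult_vec[OF pos_def_invertible[OF assms]]
  have "x \<bullet> (matrix_inv A *v y) = (A *v (matrix_inv A *v x)) \<bullet> (matrix_inv A *v y)"
    by (simp add: inv)
  also have "\<dots> = (matrix_inv A *v x) \<bullet> (A *v (matrix_inv A *v y))"
    by (simp add: pos_def_sym[OF assms])
  finally show ?thesis by (simp add: inv)
qed

text \<open>The quadratic form at \<open>x\<close> is the form of \<open>E\<close> at
  \<open>matrix_inv T *v x\<close>, which is nonzero when \<open>x\<close> is. Both limiting
  covariances have this shape.\<close>

lemma pos_def_sandwich:
  assumes "pos_def T" and "pos_def E"
  shows "pos_def (matrix_inv T ** E ** matrix_inv T)"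
proof -
  have "matrix_inv T *v x \<noteq> 0" if "x \<noteq> 0" for x
    using that matrix_inv_mult_vec(1)[OF pos_def_invertible[OF assms(1)], of x] by auto
  moreover have "x \<bullet> ((matrix_inv T ** E ** matrix_inv T) *v y)
     = (matrix_inv T *v x) \<bullet> (E *v (matrix_inv T *v y))" for x y
    by (simp add: matrix_vector_mul_assoc[symmetric] pos_def_matrix_inv_sym[OF assms(1)])
  ultimately show ?thesis
    using assms(2) unfolding pos_def_def by (metis inner_commute)
qed

lemma pos_def_mix:
  assumes "pos_def A" and "pos_def C" and "0 < t" and "t < 1"
  shows "pos_def (t *\<^sub>R A + (1 - t) *\<^sub>R C)"
  using assms unfolding pos_def_def
  by (auto simp: matrix_vector_mult_add_rdistrib scaleR_matrix_vector_assoc[symmetric]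
      inner_add_left inner_add_right intro!: add_pos_pos mult_pos_pos)

section \<open>The supremum over the mixing parameter\<close>

text \<open>The function of \<open>t\<close> is concave, and the two conditions on \<open>z\<close> say that it is stationary
  at \<open>1/2\<close>. The bound for other \<open>t\<close> is the combination with weights \<open>1 - t\<close> and \<open>t\<close> of the
  nonnegative values of the two quadratic forms at \<open>2tw - z\<close> and \<open>2(1 - t)w - z\<close>, where
  \<open>w\<close> is the mixed inverse applied to \<open>v\<close>.\<close>
lemma SUP_chernoff_eq:
  fixes A C :: "'n::finite sqmat"
  assumes A: "pos_def A" and C: "pos_def C"
    and z: "A *v z + C *v z = 2 *\<^sub>R v" and eq: "z \<bullet> (A *v z) = z \<bullet> (C *v z)"
  shows "(SUP t\<in>{0<..<1}. t * (1 - t) * sq_norm_wrt (matrix_inv (t *\<^sub>R A + (1 - t) *\<^sub>R C)) v)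
     = (z \<bullet> v) / 4"
proof (rule cSup_eq_maximum)
  note mult = matrix_vector_mult_add_rdistrib scaleR_matrix_vector_assoc[symmetric]
  \<comment> \<open>At \<open>t = 1/2\<close> the mixed inverse sends \<open>v\<close> to
    \<open>z\<close>, so the claimed maximum is attained there.\<close>
  have half: "((1/2) *\<^sub>R A + (1 - 1/2) *\<^sub>R C) *v z = v"
    using arg_cong[OF z, of "\<lambda>x. (1/2) *\<^sub>R x"] by (simp add: mult scaleR_add_right)
  have "matrix_inv ((1/2) *\<^sub>R A + (1 - 1/2) *\<^sub>R C) *v v = z"
    using matrix_inv_mult_vec(2)[OF pos_def_invertible[OF pos_def_mix[OF A C, of "1/2"]], of z]
    unfolding half by simp
  then have "(1/2) * (1 - 1/2) * sq_norm_wrt (matrix_inv ((1/2) *\<^sub>R A + (1 - 1/2) *\<^sub>R C)) v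
     = (z \<bullet> v) / 4"
    by (simp add: sq_norm_wrt_def inner_commute)
  then show "(z \<bullet> v) / 4 \<in> (\<lambda>t. t * (1 - t) * sq_norm_wrt (matrix_inv (t *\<^sub>R A + (1 - t) *\<^sub>R C)) v) ` {0<..<1}"
    by (intro image_eqI[of _ _ "1/2"]) auto
next
  fix y
  assume "y \<in> (\<lambda>t. t * (1 - t) * sq_norm_wrt (matrix_inv (t *\<^sub>R A + (1 - t) *\<^sub>R C)) v) ` {0<..<1}"
  then obtain t where t: "0 < t" "t < 1"
    and y: "y = t * (1 - t) * sq_norm_wrt (matrix_inv (t *\<^sub>R A + (1 - t) *\<^sub>R C)) v"
    by auto
  define w where "w = matrix_inv (t *\<^sub>R A + (1 - t) *\<^sub>R C) *v v"
  have "(t *\<^sub>R A + (1 - t) *\<^sub>R C) *v w = v"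
    unfolding w_def by (rule matrix_inv_mult_vec(1)[OF pos_def_invertible[OF pos_def_mix[OF A C t]]])
  then have "w \<bullet> v = w \<bullet> (t *\<^sub>R (A *v w) + (1 - t) *\<^sub>R (C *v w))"
    by (simp add: matrix_vector_mult_add_rdistrib scaleR_matrix_vector_assoc[symmetric])
  then have N: "w \<bullet> v = t * (w \<bullet> (A *v w)) + (1 - t) * (w \<bullet> (C *v w))"
    by (simp add: inner_add_right)
  have N2: "2 * (w \<bullet> v) = w \<bullet> (A *v z) + w \<bullet> (C *v z)"
    using arg_cong[OF z, of "\<lambda>x. w \<bullet> x"] by (simp add: inner_add_right)
  \<comment> \<open>Both forms take the value \<open>z \<bullet> v\<close> at \<open>z\<close>, so
    weights that add up to 1 leave exactly \<open>z \<bullet> v\<close>.\<close>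
  have Q: "z \<bullet> v = z \<bullet> (A *v z)"
    using arg_cong[OF z, of "\<lambda>x. z \<bullet> x"] eq by (simp add: inner_add_right)
  have form: "0 \<le> 4 * s\<^sup>2 * (w \<bullet> (M *v w)) - 4 * s * (w \<bullet> (M *v z)) + z \<bullet> (M *v z)"
    if M: "pos_def M" for M s
  proof -
    have "z \<bullet> (M *v w) = w \<bullet> (M *v z)"
      using pos_def_sym[OF M, of z w] by (simp add: inner_commute)
    then have "((2 * s) *\<^sub>R w - z) \<bullet> (M *v ((2 * s) *\<^sub>R w - z))
       = 4 * s\<^sup>2 * (w \<bullet> (M *v w)) - 4 * s * (w \<bullet> (M *v z)) + z \<bullet> (M *v z)"
      by (simp add: matrix_vector_mult_diff_distrib matrix_vector_mult_scaleR inner_diff_left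
          inner_diff_right power2_eq_square algebra_simps)
    then show ?thesis
      using pos_def_nonneg[OF M, of "(2 * s) *\<^sub>R w - z"] by simp
  qed
  have "0 \<le> (1 - t) * (4 * t\<^sup>2 * (w \<bullet> (A *v w)) - 4 * t * (w \<bullet> (A *v z)) + z \<bullet> (A *v z))
      + t * (4 * (1 - t)\<^sup>2 * (w \<bullet> (C *v w)) - 4 * (1 - t) * (w \<bullet> (C *v z)) + z \<bullet> (C *v z))"
    using t by (intro add_nonneg_nonneg[OF mult_nonneg_nonneg[OF _ form[OF A]]
          mult_nonneg_nonneg[OF _ form[OF C]]]) auto
  also have "\<dots> = 4 * (t * (1 - t)) * (t * (w \<bullet> (A *v w)) + (1 - t) * (w \<bullet> (C *v w)))
      - 4 * (t * (1 - t)) * (w \<bullet> (A *v z) + w \<bullet> (C *v z)) + z \<bullet> v"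
    using eq Q by (simp add: power2_eq_square algebra_simps)
  also have "\<dots> = z \<bullet> v - 4 * (t * (1 - t) * (w \<bullet> v))"
    unfolding N[symmetric] N2[symmetric] by simp
  finally show "y \<le> (z \<bullet> v) / 4"
    unfolding y sq_norm_wrt_def w_def[symmetric] by (simp add: inner_commute)
qed

text \<open>Since \<open>y\<close> is an eigenvector of \<open>T\<close> and of
  \<open>E + F\<close>, the stationarity equation is solved by a multiple of \<open>y\<close>.
  Separate eigenvector relations for \<open>E\<close> and \<open>F\<close> are replaced by the
  equality of their forms at \<open>y\<close>.\<close>

lemma SUP_chernoff_sandwich:
  fixes T E F :: "'n::finite sqmat"
  assumes T: "pos_def T" and E: "pos_def E" and F: "pos_def F"
    and Ty: "T *v y = \<theta> *\<^sub>R y" and EFy: "E *v y + F *v y = e *\<^sub>R y"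
    and eq: "y \<bullet> (E *v y) = y \<bullet> (F *v y)" and \<theta>: "\<theta> \<noteq> 0" and e: "e \<noteq> 0"
  shows "(SUP t\<in>{0<..<1}. t * (1 - t) * sq_norm_wrt (matrix_inv (t *\<^sub>R (matrix_inv T ** E ** matrix_inv T)
            + (1 - t) *\<^sub>R (matrix_inv T ** F ** matrix_inv T))) (\<gamma> *\<^sub>R y))
     = \<gamma>\<^sup>2 * \<theta>\<^sup>2 * (y \<bullet> y) / (2 * e)"
proof -
  define R where "R = matrix_inv T"
  \<comment> \<open>The two sandwiched matrices together multiply \<open>y\<close> by
    \<open>e / \<theta>\<^sup>2\<close>, and the result has to be \<open>2 * \<gamma>\<close> times
    \<open>y\<close>.\<close>
  define z where "z = (2 * \<gamma> * \<theta>\<^sup>2 / e) *\<^sub>R y"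
  have "\<theta> *\<^sub>R (R *v y) = y"
    using matrix_inv_mult_vec(2)[OF pos_def_invertible[OF T], of y]
    by (simp add: Ty R_def matrix_vector_mult_scaleR)
  then have Ry: "R *v y = (1 / \<theta>) *\<^sub>R y"
    using \<theta> by (metis divideR_right divide_inverse mult_1)
  have app: "(R ** M ** R) *v z = (2 * \<gamma> * \<theta> / e) *\<^sub>R (R *v (M *v y))" for M
    using \<theta> by (simp add: matrix_vector_mul_assoc[symmetric] z_def matrix_vector_mult_scaleR Ry
        power2_eq_square)
  have quad: "z \<bullet> ((R ** M ** R) *v z) = (2 * \<gamma> * \<theta> / e)\<^sup>2 * (y \<bullet> (M *v y))" for M
  proof -
    have "z \<bullet> (R *v (M *v y)) = (2 * \<gamma> * \<theta> / e) * (y \<bullet> (M *v y))"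
      using \<theta> unfolding R_def pos_def_matrix_inv_sym[OF T]
      by (simp add: R_def[symmetric] z_def matrix_vector_mult_scaleR Ry power2_eq_square)
    then show ?thesis
      unfolding app by (simp add: power2_eq_square)
  qed
  have "(R ** E ** R) *v z + (R ** F ** R) *v z = (2 * \<gamma> * \<theta> / e) *\<^sub>R (R *v (E *v y + F *v y))"
    by (simp add: app matrix_vector_right_distrib scaleR_add_right)
  also have "\<dots> = 2 *\<^sub>R (\<gamma> *\<^sub>R y)"
    using \<theta> e by (simp add: EFy matrix_vector_mult_scaleR Ry)
  finally have "(R ** E ** R) *v z + (R ** F ** R) *v z = 2 *\<^sub>R (\<gamma> *\<^sub>R y)" .
  then have "(SUP t\<in>{0<..<1}. t * (1 - t) * sq_norm_wrt (matrix_inv (t *\<^sub>R (R ** E ** R)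
            + (1 - t) *\<^sub>R (R ** F ** R))) (\<gamma> *\<^sub>R y)) = (z \<bullet> (\<gamma> *\<^sub>R y)) / 4"
    by (intro SUP_chernoff_eq) (simp_all add: R_def pos_def_sandwich T E F quad[unfolded R_def] eq)
  also have "\<dots> = \<gamma>\<^sup>2 * \<theta>\<^sup>2 * (y \<bullet> y) / (2 * e)"
    by (simp add: z_def power2_eq_square)
  finally show ?thesis unfolding R_def .
qed

section \<open>Weighted sums of rank-one matrices\<close>

lemma outer_prod_mult_vec: "outer_prod x x *v y = (x \<bullet> y) *\<^sub>R x"
  by (simp add: vec_eq_iff outer_prod_def matrix_vector_mult_def inner_vec_def sum_distrib_right
      sum_distrib_left mult_ac)

lemma sum_mult_vec:
  fixes f :: "'a \<Rightarrow> 'n::finite sqmat"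
  shows "(\<Sum>j\<in>S. f j) *v y = (\<Sum>j\<in>S. f j *v y)"
  by (induction S rule: infinite_finite_induct) (simp_all add: matrix_vector_mult_add_rdistrib)

lemma sum_outer_prod_mult_vec:
  "(\<Sum>j\<in>S. c j *\<^sub>R outer_prod (w j) (w j)) *v y = (\<Sum>j\<in>S. (c j * (w j \<bullet> y)) *\<^sub>R w j)"
  by (simp add: sum_mult_vec scaleR_matrix_vector_assoc[symmetric] outer_prod_mult_vec)

lemma inner_sum_outer_prod:
  "x \<bullet> ((\<Sum>j\<in>S. c j *\<^sub>R outer_prod (w j) (w j)) *v y) = (\<Sum>j\<in>S. c j * (w j \<bullet> x) * (w j \<bullet> y))"
  by (simp add: sum_outer_prod_mult_vec inner_sum_right inner_commute mult_ac)

text \<open>The form at \<open>x\<close> is the weighted sum of the squares of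
  \<open>w j \<bullet> x\<close>, which vanishes only if \<open>x\<close> is orthogonal to every
  \<open>w j\<close>.\<close>

lemma pos_def_sum_outer_prod:
  assumes "finite S" and pos: "\<And>j. j \<in> S \<Longrightarrow> 0 < c j"
    and span: "\<And>y. (\<And>j. j \<in> S \<Longrightarrow> w j \<bullet> y = 0) \<Longrightarrow> y = 0"
  shows "pos_def (\<Sum>j\<in>S. c j *\<^sub>R outer_prod (w j) (w j))"
  unfolding pos_def_def
proof (intro conjI allI impI)
  fix x y
  let ?M = "\<Sum>j\<in>S. c j *\<^sub>R outer_prod (w j) (w j)"
  show "x \<bullet> (?M *v y) = (?M *v x) \<bullet> y"
    unfolding inner_commute[of "?M *v x"] inner_sum_outer_prod by (simp add: mult_ac)
next
  fix x :: "'b rvec"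
  assume "x \<noteq> 0"
  then obtain j where j: "j \<in> S" "w j \<bullet> x \<noteq> 0"
    using span by blast
  have "0 < (\<Sum>j\<in>S. c j * (w j \<bullet> x)\<^sup>2)"
    using j by (intro sum_pos2[OF assms(1) j(1)]) (auto intro: mult_pos_pos mult_nonneg_nonneg pos less_imp_le[OF pos])
  then show "0 < x \<bullet> ((\<Sum>j\<in>S. c j *\<^sub>R outer_prod (w j) (w j)) *v x)"
    by (simp add: inner_sum_outer_prod power2_eq_square mult_ac)
qed

text \<open>Lets a formula for block \<open>k\<close> acting on \<open>\<nu> k - \<nu> l\<close> be
  reused for block \<open>l\<close> with the roles exchanged.\<close>

lemma matrix_vector_mult_diff_swap:
  fixes M :: "(real, 'n::finite) vec ^ 'm::finite"
  shows "M *v (x - y) = - (M *v (y - x))"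
  by (simp add: matrix_vector_mult_diff_distrib)

section \<open>Existence and uniqueness of the Cholesky factor\<close>

text \<open>Row \<open>j\<close> vanishes beyond the diagonal. With the term at \<open>j\<close>
  split off, this is the recursion that computes column \<open>j\<close> from the earlier
  columns.\<close>

lemma lower_triangular_row_inner:
  fixes X :: "'k::{finite,linorder} sqmat"
  assumes "\<And>i j. i < j \<Longrightarrow> X $ i $ j = 0"
  shows "(X ** transpose X) $ i $ j = (\<Sum>r | r < j. X $ i $ r * X $ j $ r) + X $ i $ j * X $ j $ j"
proof -
  have "(X ** transpose X) $ i $ j = (\<Sum>r\<in>UNIV. X $ i $ r * X $ j $ r)"
    by (simp add: matrix_matrix_mult_def transpose_def)
  also have "\<dots> = (\<Sum>r\<in>insert j {r. r < j}. X $ i $ r * X $ j $ r)"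
  proof (rule sum.mono_neutral_right, simp_all, intro ballI)
    fix r
    assume "r \<in> UNIV - insert j {r. r < j}"
    then have "j < r" by auto
    then show "X $ i $ r = 0 \<or> X $ j $ r = 0" by (simp add: assms)
  qed
  finally show ?thesis by (simp add: add.commute)
qed

text \<open>Once the earlier columns agree, so do the squares of the diagonal entries; positivity
  fixes the entry, and dividing by it fixes the column.\<close>

lemma is_cholesky_factor_unique:
  assumes X: "is_cholesky_factor B X" and Y: "is_cholesky_factor B Y"
  shows "X = Y"
proof -
  have X0: "\<And>i j. i < j \<Longrightarrow> X $ i $ j = 0" and Y0: "\<And>i j. i < j \<Longrightarrow> Y $ i $ j = 0"
    and pos: "\<And>i. 0 < X $ i $ i" "\<And>i. 0 < Y $ i $ i"
    and XY: "X ** transpose X = Y ** transpose Y"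
    using X Y unfolding is_cholesky_factor_def by auto
  have "\<forall>i. X $ i $ j = Y $ i $ j" for j
  \<comment> \<open>The number of smaller indices serves as the rank of \<open>j\<close> in the
    finite order.\<close>
  proof (induction "card {r. r < j}" arbitrary: j rule: less_induct)
    case less
    have IH: "X $ i $ r = Y $ i $ r" if "r < j" for i r
    proof -
      have "{r'. r' < r} \<subset> {r. r < j}" using that by auto
      then show ?thesis using less[of r] by (simp add: psubset_card_mono)
    qed
    have *: "X $ i $ j * X $ j $ j = Y $ i $ j * Y $ j $ j" for i
      using lower_triangular_row_inner[OF X0, of i j] lower_triangular_row_inner[OF Y0, of i j] XY
      by (simp add: IH)
    have "X $ j $ j = Y $ j $ j"
      using *[of j] pos[of j]
      by (metis abs_of_pos power2_eq_square power2_eq_iff_nonneg less_imp_le)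
    with * pos(2)[of j] show ?case by auto
  qed
  then show ?thesis by (simp add: vec_eq_iff)
qed

text \<open>The rank maps the indices below \<open>i\<close> bijectively onto an initial segment of
  the naturals, where sums can telescope.\<close>

lemma sum_card_less:
  fixes f :: "nat \<Rightarrow> 'a::comm_monoid_add" and i :: "'k::{finite,linorder}"
  shows "(\<Sum>j | j < i. f (card {r. r < j})) = (\<Sum>n<card {r. r < i}. f n)"
proof -
  have inj: "inj_on (\<lambda>j. card {r. r < j}) {j. j < i}"
  proof (rule inj_onI, rule ccontr)
    fix x y :: 'k
    assume eq: "card {r. r < x} = card {r. r < y}" and "x \<noteq> y"
    then consider "x < y" | "y < x" by (meson linorder_less_linear)
    then have "{r. r < x} \<subset> {r. r < y} \<or> {r. r < y} \<subset> {r. r < x}"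
      by cases auto
    then show False
      using eq psubset_card_mono[of "{r. r < x}" "{r. r < y}"]
        psubset_card_mono[of "{r. r < y}" "{r. r < x}"] by auto
  qed
  have "(\<lambda>j. card {r. r < j}) ` {j. j < i} = {..<card {r. r < i}}"
  proof (rule card_subset_eq)
    show "(\<lambda>j. card {r. r < j}) ` {j. j < i} \<subseteq> {..<card {r. r < i}}"
      by (auto intro!: psubset_card_mono)
  qed (simp_all add: card_image[OF inj])
  then show ?thesis
    using sum.reindex[OF inj, of f] by simp
qed

text \<open>After \<open>n\<close> elimination steps the Schur complement has the same shape, with the same
  \<open>a - b\<close> and with \<open>b\<close> replaced by \<open>s n = b(a - b)/(a - b + nb)\<close>.\<close>
lemma ex_cholesky_factor_two_valued:
  fixes a b :: real
  assumes "0 < b" and "b < a"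
  shows "\<exists>X::'k::{finite,linorder} sqmat. is_cholesky_factor (\<chi> i j. if i = j then a else b) X"
proof -
  define s where "s n = b * (a - b) / (a - b + real n * b)" for n
  define p where "p i = card {r. r < i}" for i :: 'k
  \<comment> \<open>The entry below the diagonal in the column of rank \<open>n\<close>: the Schur
    complement value \<open>s n\<close> divided by the diagonal entry of that column.\<close>
  define c where "c n = s n / sqrt (a - b + s n)" for n
  define X :: "'k sqmat" where
    "X = (\<chi> i j. if j < i then c (p j) else if i = j then sqrt (a - b + s (p i)) else 0)"
  have s_pos: "0 < s n" for n
    using assms unfolding s_def by (intro divide_pos_pos mult_pos_pos add_pos_nonneg) auto
  have d_pos: "0 < a - b + s n" for n
    using assms s_pos[of n] by linarith
  \<comment> \<open>Each elimination lowers the off-diagonal value by the square of the entry. The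
    squares therefore telescope, starting from \<open>s 0 = b\<close>.\<close>
  have step: "(c n)\<^sup>2 = s n - s (Suc n)" for n
  proof -
    define u where "u = a - b"
    define q where "q = u + real n * b"
    have u: "0 < u" "0 < q" using assms by (auto simp: u_def q_def intro: add_pos_nonneg)
    have sn: "s n = b * u / q" "s (Suc n) = b * u / (q + b)"
      by (simp_all add: s_def u_def q_def algebra_simps)
    have "(c n)\<^sup>2 = (s n)\<^sup>2 / (u + s n)"
      using d_pos[of n] by (simp add: c_def power_divide u_def)
    also have "u + s n = u * (q + b) / q"
      using u by (simp add: sn field_simps)
    also have "(s n)\<^sup>2 / (u * (q + b) / q) = b * u / q - b * u / (q + b)"
    proof -
      have "u \<noteq> 0" "q \<noteq> 0" "q + b \<noteq> 0" using u assms by auto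
      then show ?thesis
        unfolding sn by (simp add: divide_simps) (simp add: power2_eq_square algebra_simps)
    qed
    finally show ?thesis by (simp add: sn)
  qed
  have c_sum: "(\<Sum>n<m. (c n)\<^sup>2) = b - s m" for m
  proof (induction m)
    case 0
    then show ?case using assms by (simp add: s_def)
  qed (simp add: step)
  have X0: "\<And>i j. i < j \<Longrightarrow> X $ i $ j = 0"
    by (auto simp: X_def)
  have diag: "(X ** transpose X) $ i $ i = a" for i
  proof -
    have "(\<Sum>r | r < i. X $ i $ r * X $ i $ r) = (\<Sum>r | r < i. (c (p r))\<^sup>2)"
      by (intro sum.cong) (auto simp: X_def power2_eq_square)
    also have "\<dots> = b - s (p i)"
      unfolding p_def sum_card_less[of "\<lambda>n. (c n)\<^sup>2"] c_sum ..
    finally show ?thesis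
      using lower_triangular_row_inner[OF X0, of i i] d_pos[of "p i"] by (simp add: X_def)
  qed
  have off: "(X ** transpose X) $ i $ j = b" if "j < i" for i j
  proof -
    have "(\<Sum>r | r < j. X $ i $ r * X $ j $ r) = (\<Sum>r | r < j. (c (p r))\<^sup>2)"
      using that by (intro sum.cong) (auto simp: X_def power2_eq_square)
    also have "\<dots> = b - s (p j)"
      unfolding p_def sum_card_less[of "\<lambda>n. (c n)\<^sup>2"] c_sum ..
    finally have "(\<Sum>r | r < j. X $ i $ r * X $ j $ r) = b - s (p j)" .
    moreover have "X $ i $ j * X $ j $ j = s (p j)"
      using that d_pos[of "p j"] by (simp add: X_def c_def)
    ultimately show ?thesis
      using lower_triangular_row_inner[OF X0, of i j] by simp
  qed
  have sym: "(X ** transpose X) $ i $ j = (X ** transpose X) $ j $ i" for i j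
    by (simp add: matrix_matrix_mult_def transpose_def mult.commute)
  have "X ** transpose X = (\<chi> i j. if i = j then a else b)"
    unfolding vec_eq_iff using diag off sym by simp (metis linorder_less_linear)
  then have "is_cholesky_factor (\<chi> i j. if i = j then a else b) X"
    using X0 d_pos by (simp add: is_cholesky_factor_def) (simp add: X_def)
  then show ?thesis by blast
qed

text \<open>Existence and uniqueness together make the definite description in
  \<open>cholesky_factor\<close> denote an actual factor.\<close>

lemma latent_pos_inner:
  assumes "\<exists>X. is_cholesky_factor B X"
  shows "latent_pos B i \<bullet> latent_pos B j = B $ i $ j"
proof -
  have "is_cholesky_factor B (cholesky_factor B)"
    unfolding cholesky_factor_def using assms is_cholesky_factor_unique by (metis theI)
  then have "B $ i $ j = (cholesky_factor B ** transpose (cholesky_factor B)) $ i $ j"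
    by (simp add: is_cholesky_factor_def)
  then show ?thesis
    by (simp add: latent_pos_def row_def inner_vec_def matrix_matrix_mult_def transpose_def)
qed

section \<open>Latent positions with a two-valued Gram matrix\<close>

text \<open>Of the factorisation only the Gram matrix is kept. \<open>K\<close> is the number of
  blocks as a real number.\<close>

locale two_valued_gram =
  fixes \<nu> :: "'k::finite \<Rightarrow> 'k rvec" and p :: "'k pmf" and a b K :: real
  assumes K_def: "K = real CARD('k)" and b_pos: "0 < b" and b_less_a: "b < a" and a_less_1: "a < 1"
    and gram: "\<nu> i \<bullet> \<nu> j = (if i = j then a else b)"
    and unif: "pmf p k = 1 / K"
begin

definition \<sigma> :: real where "\<sigma> = a + (K - 1) * b"
definition \<alpha> :: real where "\<alpha> = a * (1 - a)"
definition \<beta> :: real where "\<beta> = b * (1 - b)"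
text \<open>Half the eigenvalue of the Laplacian second moment matrix on differences of latent
  positions.\<close>

definition r :: real where "r = (a - b) / (2 * \<sigma>)"
definition h :: "'k \<Rightarrow> 'k \<Rightarrow> real" where "h k j = (if j = k then \<alpha> else \<beta>)"
text \<open>Half the Laplacian second moment matrix applied to \<open>\<nu> k\<close>. The vectors
  averaged in \<open>Sigma_LSE\<close> are \<open>K / \<sigma>\<close> times
  \<open>\<nu> j - q k\<close>.\<close>

definition q :: "'k \<Rightarrow> 'k rvec" where "q k = (1 / (2 * \<sigma>)) *\<^sub>R (\<Sum>j\<in>UNIV. (\<nu> j \<bullet> \<nu> k) *\<^sub>R \<nu> j)"
text \<open>The sum over \<open>j\<close> of \<open>h k j\<close> times the square of
  \<open>\<nu> j - q k\<close> paired with \<open>\<nu> k - \<nu> l\<close>, divided by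
  \<open>(a - b)\<^sup>2\<close>: the terms are \<open>j = k\<close>, \<open>j = l\<close> and the
  other \<open>K - 2\<close> blocks.\<close>

definition L :: real where "L = \<alpha> * (1 - r)\<^sup>2 + \<beta> * (1 + r)\<^sup>2 + (K - 2) * \<beta> * r\<^sup>2"

lemma K_ge_1: "1 \<le> K"
  using zero_less_card_finite[where 'a='k] unfolding K_def by simp

lemma constants_pos: "0 < \<sigma>" "0 < \<alpha>" "0 < \<beta>" "0 < h k j"
proof -
  show "0 < \<sigma>" unfolding \<sigma>_def using K_ge_1 b_pos b_less_a by (intro add_pos_nonneg) auto
  show "0 < \<alpha>" "0 < \<beta>" unfolding \<alpha>_def \<beta>_def using b_pos b_less_a a_less_1 by auto
  then show "0 < h k j" by (simp add: h_def)
qed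

lemma expectation_eq:
  fixes f :: "'k rvec \<Rightarrow> 'b::{banach, second_countable_topology}"
  shows "measure_pmf.expectation (map_pmf \<nu> p) f = (1 / K) *\<^sub>R (\<Sum>j\<in>UNIV. f (\<nu> j))"
  by (simp add: integral_measure_pmf[of UNIV] unif scaleR_sum_right)

lemma sum_inner: "(\<Sum>j\<in>UNIV. \<nu> j) \<bullet> \<nu> k = \<sigma>"
proof -
  have "(\<Sum>j\<in>UNIV. \<nu> j) \<bullet> \<nu> k = (\<Sum>j\<in>UNIV. (a - b) * (if j = k then 1 else 0) + b)"
    unfolding inner_sum_left by (intro sum.cong) (auto simp: gram)
  also have "\<dots> = \<sigma>"
    unfolding sum.distrib sum_distrib_left[symmetric] by (simp add: \<sigma>_def K_def[symmetric] algebra_simps)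
  finally show ?thesis .
qed

lemma mean_inner: "latent_mean (map_pmf \<nu> p) \<bullet> \<nu> k = \<sigma> / K"
  by (simp add: latent_mean_def expectation_eq sum_inner del: integral_map_pmf)

lemma bern_var_eq: "bern_var (\<nu> k) (\<nu> j) = h k j"
  by (simp add: bern_var_def gram h_def \<alpha>_def \<beta>_def)

text \<open>The Gram matrix is \<open>b\<close> times the all-ones matrix plus \<open>a - b\<close>
  times the identity.\<close>

lemma sum_weighted:
  "(\<Sum>j\<in>UNIV. (\<nu> j \<bullet> \<nu> k) *\<^sub>R \<nu> j) = b *\<^sub>R (\<Sum>j\<in>UNIV. \<nu> j) + (a - b) *\<^sub>R \<nu> k"
proof -
  have "(\<Sum>j\<in>UNIV. (\<nu> j \<bullet> \<nu> k) *\<^sub>R \<nu> j)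
     = (\<Sum>j\<in>UNIV. b *\<^sub>R \<nu> j + (if j = k then (a - b) *\<^sub>R \<nu> k else 0))"
    by (intro sum.cong) (auto simp: gram scaleR_left_distrib[symmetric])
  then show ?thesis by (simp add: sum.distrib scaleR_sum_right)
qed

text \<open>The Gram matrix is nonsingular, so forming linear combinations is injective and, by
  equality of dimensions, surjective. Thus \<open>y\<close> is a combination of vectors orthogonal
  to it.\<close>

lemma spanning:
  assumes "\<And>j. \<nu> j \<bullet> y = 0"
  shows "y = 0"
proof -
  define f where "f c = (\<Sum>j\<in>UNIV. c $ j *\<^sub>R \<nu> j)" for c :: "'k rvec"
  have lin: "linear f"
    by (rule linearI) (simp_all add: f_def scaleR_left_distrib sum.distrib scaleR_sum_right)
  have "c = 0" if "f c = 0" for c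
  proof -
    define S where "S = (\<Sum>j\<in>UNIV. c $ j)"
    have *: "b * S + (a - b) * c $ k = 0" for k
    proof -
      have "0 = f c \<bullet> \<nu> k" using that by simp
      also have "\<dots> = (\<Sum>j\<in>UNIV. b * c $ j + (if j = k then (a - b) * c $ k else 0))"
        unfolding f_def inner_sum_left by (intro sum.cong) (auto simp: gram algebra_simps)
      also have "\<dots> = b * S + (a - b) * c $ k"
        by (simp add: sum.distrib sum_distrib_left S_def)
      finally show ?thesis ..
    qed
    \<comment> \<open>Adding up the equations over all \<open>k\<close> isolates the coefficient sum
      \<open>S\<close>; once it vanishes, each equation gives a zero coefficient.\<close>
    have "0 = (\<Sum>k\<in>UNIV. b * S + (a - b) * c $ k)"
      unfolding * by simp
    also have "\<dots> = K * (b * S) + (a - b) * S"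
      unfolding sum.distrib sum_distrib_left[symmetric] S_def[symmetric] by (simp add: K_def)
    also have "\<dots> = (K * b + (a - b)) * S"
      by (simp add: algebra_simps)
    finally have "(K * b + (a - b)) * S = 0" ..
    moreover have "0 < K * b + (a - b)"
      using b_pos b_less_a K_ge_1 by (intro add_nonneg_pos) auto
    ultimately have "S = 0" by simp
    with * b_less_a show "c = 0" by (simp add: vec_eq_iff)
  qed
  then have "inj f" using lin by (simp add: linear_injective_0)
  then have "surj f" by (intro linear_injective_imp_surjective[OF lin]) auto
  then obtain c where "y = f c" by (metis surjD)
  then have "y \<bullet> y = (\<Sum>j\<in>UNIV. c $ j * (\<nu> j \<bullet> y))"
    by (simp add: f_def inner_sum_left)
  with assms show ?thesis by simp
qed

section \<open>Second moment matrices\<close>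

definition T :: "real \<Rightarrow> 'k sqmat" where
  "T \<kappa> = (\<Sum>j\<in>UNIV. \<kappa> *\<^sub>R outer_prod (\<nu> j) (\<nu> j))"

lemma Delta_eq: "Delta (map_pmf \<nu> p) = T (1 / K)"
  by (simp add: Delta_def expectation_eq T_def scaleR_sum_right del: integral_map_pmf)

lemma Delta_tilde_eq: "Delta_tilde (map_pmf \<nu> p) = T (1 / \<sigma>)"
proof -
  have "K \<noteq> 0" using K_ge_1 by simp
  then show ?thesis
    by (simp add: Delta_tilde_def expectation_eq mean_inner T_def scaleR_sum_right inverse_eq_divide
        del: integral_map_pmf)
qed

lemma pos_def_T: "0 < \<kappa> \<Longrightarrow> pos_def (T \<kappa>)"
  unfolding T_def by (rule pos_def_sum_outer_prod) (auto intro: spanning)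

text \<open>The all-ones part of the Gram matrix contributes the same vector for \<open>k\<close>
  and \<open>l\<close> and cancels.\<close>

lemma T_eigen: "T \<kappa> *v (\<nu> k - \<nu> l) = (\<kappa> * (a - b)) *\<^sub>R (\<nu> k - \<nu> l)"
proof -
  have "T \<kappa> *v (\<nu> k - \<nu> l)
     = \<kappa> *\<^sub>R ((\<Sum>j\<in>UNIV. (\<nu> j \<bullet> \<nu> k) *\<^sub>R \<nu> j) - (\<Sum>j\<in>UNIV. (\<nu> j \<bullet> \<nu> l) *\<^sub>R \<nu> j))"
    by (simp add: T_def sum_outer_prod_mult_vec inner_diff_right sum_subtractf[symmetric]
        scaleR_left_diff_distrib scaleR_right_diff_distrib right_diff_distrib scaleR_sum_right)
  then show ?thesis by (simp add: sum_weighted scaleR_right_diff_distrib)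
qed

lemma diff_inner_self: "k \<noteq> l \<Longrightarrow> (\<nu> k - \<nu> l) \<bullet> (\<nu> k - \<nu> l) = 2 * (a - b)"
  by (simp add: inner_diff_left inner_diff_right gram)

lemma inner_diff: "\<nu> j \<bullet> (\<nu> k - \<nu> l) = (a - b) * ((if j = k then 1 else 0) - (if j = l then 1 else 0))"
  by (simp add: inner_diff_right gram)

lemma sum_two:
  fixes f :: "'k \<Rightarrow> 'b::ab_group_add"
  assumes "k \<noteq> l"
  shows "(\<Sum>j\<in>UNIV. f j) = f k + f l + (\<Sum>j\<in>UNIV - {k, l}. f j)"
  using assms sum.subset_diff[of "{k, l}" UNIV f] by (simp add: add.commute)

section \<open>Inner expectations of the two covariances\<close>

definition E_ASE :: "'k \<Rightarrow> 'k sqmat" where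
  "E_ASE k = (\<Sum>j\<in>UNIV. (h k j / K) *\<^sub>R outer_prod (\<nu> j) (\<nu> j))"

text \<open>The factor \<open>K\<^sup>2 / \<sigma> ^ 3\<close> collects \<open>1 / K\<close> from
  the uniform law, \<open>K / \<sigma>\<close> from the division by the mean inner product, and the
  square of the scale \<open>K / \<sigma>\<close> of the vectors.\<close>

definition E_LSE :: "'k \<Rightarrow> 'k sqmat" where
  "E_LSE k = (\<Sum>j\<in>UNIV. (h k j * K\<^sup>2 / \<sigma> ^ 3) *\<^sub>R outer_prod (\<nu> j - q k) (\<nu> j - q k))"

lemma Sigma_ASE_eq:
  "Sigma_ASE (map_pmf \<nu> p) (\<nu> k) = matrix_inv (T (1 / K)) ** E_ASE k ** matrix_inv (T (1 / K))"
  by (simp add: Sigma_ASE_def Delta_eq expectation_eq E_ASE_def bern_var_eq scaleR_sum_right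
      del: integral_map_pmf)

lemma outer_prod_scaleR: "outer_prod (c *\<^sub>R x) (d *\<^sub>R y) = (c * d) *\<^sub>R outer_prod x y"
  by (simp add: outer_prod_def vec_eq_iff)

lemma Sigma_LSE_eq:
  "Sigma_LSE (map_pmf \<nu> p) (\<nu> k) = matrix_inv (T (1 / \<sigma>)) ** E_LSE k ** matrix_inv (T (1 / \<sigma>))"
proof -
  have q: "T (1 / \<sigma>) *v \<nu> k = 2 *\<^sub>R q k"
    by (simp add: T_def sum_outer_prod_mult_vec q_def scaleR_sum_right)
  have w: "(K / \<sigma>) *\<^sub>R \<nu> j - (K / (2 * \<sigma>)) *\<^sub>R (T (1 / \<sigma>) *v \<nu> k)
     = (K / \<sigma>) *\<^sub>R (\<nu> j - q k)" for j
    unfolding q by (simp add: scaleR_right_diff_distrib)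
  show ?thesis
    using constants_pos(1) K_ge_1
    by (simp add: Sigma_LSE_def Let_def Delta_tilde_eq expectation_eq mean_inner w bern_var_eq
        outer_prod_scaleR E_LSE_def scaleR_sum_right power2_eq_square power3_eq_cube mult.assoc
        del: integral_map_pmf)
qed

lemma pos_def_E_ASE: "pos_def (E_ASE k)"
  unfolding E_ASE_def using constants_pos(4) K_ge_1
  by (intro pos_def_sum_outer_prod) (auto intro: spanning)

text \<open>If all \<open>\<nu> j \<bullet> y\<close> equal \<open>q k \<bullet> y\<close>, then \<open>q k \<bullet> y\<close> is half of itself.\<close>
lemma pos_def_E_LSE: "pos_def (E_LSE k)"
  unfolding E_LSE_def
proof (rule pos_def_sum_outer_prod)
  fix y
  assume "\<And>j. j \<in> UNIV \<Longrightarrow> (\<nu> j - q k) \<bullet> y = 0"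
  then have eq: "\<nu> j \<bullet> y = q k \<bullet> y" for j
    by (simp add: inner_diff_left)
  have "q k \<bullet> y = (1 / (2 * \<sigma>)) * (\<Sum>j\<in>UNIV. (\<nu> j \<bullet> \<nu> k) * (\<nu> j \<bullet> y))"
    by (simp add: q_def inner_sum_left)
  also have "\<dots> = (1 / (2 * \<sigma>)) * (((\<Sum>j\<in>UNIV. \<nu> j) \<bullet> \<nu> k) * (q k \<bullet> y))"
    by (simp add: eq inner_sum_left sum_distrib_right)
  also have "\<dots> = (q k \<bullet> y) / 2"
    using constants_pos(1) by (simp add: sum_inner)
  finally have "q k \<bullet> y = 0" by simp
  with eq show "y = 0" by (intro spanning) simp
qed (use constants_pos(1) constants_pos(4) K_ge_1 in auto)

text \<open>Every \<open>\<nu> j\<close> other than \<open>\<nu> k\<close> and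
  \<open>\<nu> l\<close> is orthogonal to the difference, so two terms survive. Their weights
  \<alpha> and \<beta> even out when block \<open>l\<close> is added.\<close>

lemma E_ASE_mult:
  assumes "k \<noteq> l"
  shows "E_ASE k *v (\<nu> k - \<nu> l) = ((a - b) / K) *\<^sub>R (\<alpha> *\<^sub>R \<nu> k - \<beta> *\<^sub>R \<nu> l)"
proof -
  have "E_ASE k *v (\<nu> k - \<nu> l) = (\<Sum>j\<in>UNIV. (h k j / K * (\<nu> j \<bullet> (\<nu> k - \<nu> l))) *\<^sub>R \<nu> j)"
    by (simp add: E_ASE_def sum_outer_prod_mult_vec)
  also have "\<dots> = ((a - b) / K) *\<^sub>R (\<alpha> *\<^sub>R \<nu> k - \<beta> *\<^sub>R \<nu> l)"
    unfolding sum_two[OF assms] inner_diff using assms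
    by (simp add: h_def scaleR_right_diff_distrib mult.commute del: minus_diff_eq)
  finally show ?thesis .
qed

lemma q_inner: "k \<noteq> l \<Longrightarrow> q k \<bullet> (\<nu> k - \<nu> l) = (a - b) * r"
  unfolding q_def sum_weighted by (simp add: inner_diff_right inner_add_left sum_inner gram r_def
      diff_divide_distrib[symmetric] right_diff_distrib)

lemma q_diff: "q k - q l = r *\<^sub>R (\<nu> k - \<nu> l)"
  unfolding q_def sum_weighted by (simp add: scaleR_right_diff_distrib scaleR_add_right r_def)

text \<open>The shift by \<open>q k\<close> makes the other \<open>K - 2\<close> blocks contribute
  as well, all with the same weight.\<close>

lemma E_LSE_mult:
  assumes "k \<noteq> l"
  shows "E_LSE k *v (\<nu> k - \<nu> l) = ((a - b) * K\<^sup>2 / \<sigma> ^ 3) *\<^sub>R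
     ((\<alpha> * (1 - r)) *\<^sub>R (\<nu> k - q k) - (\<beta> * (1 + r)) *\<^sub>R (\<nu> l - q k)
       - (\<beta> * r) *\<^sub>R ((\<Sum>j\<in>UNIV. \<nu> j) - \<nu> k - \<nu> l - (K - 2) *\<^sub>R q k))"
proof -
  \<comment> \<open>The values are \<open>1 - r\<close> at \<open>k\<close>, \<open>-1 - r\<close>
    at \<open>l\<close> and \<open>-r\<close> elsewhere; the shift \<open>r\<close> comes from
    \<open>q_inner\<close>.\<close>
  define d where "d j = (if j = k then 1 else 0) - (if j = l then 1 else 0) - r" for j
  have ip: "(\<nu> j - q k) \<bullet> (\<nu> k - \<nu> l) = (a - b) * d j" for j
    by (simp add: inner_diff_left[of "\<nu> j" "q k"] inner_diff q_inner[OF assms] d_def right_diff_distrib)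
  have "E_LSE k *v (\<nu> k - \<nu> l)
     = (\<Sum>j\<in>UNIV. (h k j * K\<^sup>2 / \<sigma> ^ 3 * ((\<nu> j - q k) \<bullet> (\<nu> k - \<nu> l))) *\<^sub>R (\<nu> j - q k))"
    by (simp add: E_LSE_def sum_outer_prod_mult_vec)
  also have "\<dots> = ((a - b) * K\<^sup>2 / \<sigma> ^ 3) *\<^sub>R (\<Sum>j\<in>UNIV. (h k j * d j) *\<^sub>R (\<nu> j - q k))"
    unfolding ip scaleR_sum_right by (intro sum.cong) (simp_all add: mult_ac)
  also have "(\<Sum>j\<in>UNIV. (h k j * d j) *\<^sub>R (\<nu> j - q k))
     = (\<alpha> * (1 - r)) *\<^sub>R (\<nu> k - q k) + (- (\<beta> * (1 + r))) *\<^sub>R (\<nu> l - q k)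
       + (\<Sum>j\<in>UNIV - {k, l}. (- (\<beta> * r)) *\<^sub>R (\<nu> j - q k))"
    unfolding sum_two[OF assms] using assms
    by (intro arg_cong2[where f = "(+)"] sum.cong) (auto simp: h_def d_def algebra_simps)
  also have "(\<Sum>j\<in>UNIV - {k, l}. (- (\<beta> * r)) *\<^sub>R (\<nu> j - q k))
     = (- (\<beta> * r)) *\<^sub>R ((\<Sum>j\<in>UNIV - {k, l}. \<nu> j) - (\<Sum>j\<in>UNIV - {k, l}. q k))"
    by (simp only: scaleR_sum_right[symmetric] sum_subtractf)
  also have "(\<Sum>j\<in>UNIV - {k, l}. \<nu> j) = (\<Sum>j\<in>UNIV. \<nu> j) - \<nu> k - \<nu> l"
    by (simp add: sum_two[OF assms])
  also have "(\<Sum>j\<in>UNIV - {k, l}. q k) = (K - 2) *\<^sub>R q k"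
  proof -
    have "(\<Sum>j\<in>(UNIV::'k set). q k) = q k + q k + (\<Sum>j\<in>UNIV - {k, l}. q k)"
      by (rule sum_two[OF assms, of "\<lambda>_. q k"])
    then have "(\<Sum>j\<in>UNIV - {k, l}. q k) = K *\<^sub>R q k - q k - q k"
      by (simp add: sum_constant_scaleR K_def del: sum_constant)
    then show ?thesis by (simp add: scaleR_left_diff_distrib scaleR_2)
  qed
  finally show ?thesis
    by simp
qed

text \<open>The value is the same for every pair of blocks, which supplies the equality of forms
  that puts the maximum at 1/2.\<close>

lemma E_LSE_quad:
  assumes "k \<noteq> l"
  shows "(\<nu> k - \<nu> l) \<bullet> (E_LSE k *v (\<nu> k - \<nu> l)) = (a - b)\<^sup>2 * K\<^sup>2 / \<sigma> ^ 3 * L"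
proof -
  let ?y = "\<nu> k - \<nu> l"
  have ip: "?y \<bullet> \<nu> k = a - b" "?y \<bullet> \<nu> l = - (a - b)" "?y \<bullet> q k = (a - b) * r"
    "?y \<bullet> (\<Sum>j\<in>UNIV. \<nu> j) = 0"
    using assms q_inner[OF assms]
    by (simp_all add: inner_commute[of ?y] inner_diff) (simp add: inner_diff_right sum_inner)
  have "\<alpha> * (1 - r) * ((a - b) - (a - b) * r) - \<beta> * (1 + r) * (- (a - b) - (a - b) * r)
      - \<beta> * r * (0 - (a - b) - - (a - b) - (K - 2) * ((a - b) * r)) = (a - b) * L"
    unfolding L_def power2_eq_square by algebra
  then show ?thesis
    unfolding E_LSE_mult[OF assms] inner_scaleR_right inner_diff_right[of ?y] ip
    by (simp add: power2_eq_square)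
qed

text \<open>Exchanging \<open>k\<close> and \<open>l\<close> and subtracting cancels the sum over
  all blocks; the shifts enter through \<open>q k - q l\<close>, itself a multiple of the
  difference.\<close>

lemma E_LSE_eigen:
  assumes "k \<noteq> l"
  shows "E_LSE k *v (\<nu> k - \<nu> l) + E_LSE l *v (\<nu> k - \<nu> l)
     = ((a - b) * K\<^sup>2 / \<sigma> ^ 3 * L) *\<^sub>R (\<nu> k - \<nu> l)"
proof -
  have ql: "q l = q k - r *\<^sub>R (\<nu> k - \<nu> l)"
    using q_diff[of k l] by (simp add: algebra_simps)
  define n where "n = (\<Sum>j\<in>UNIV. \<nu> j)"
  define u where "u = (\<alpha> * (1 - r)) *\<^sub>R (\<nu> k - q k) - (\<beta> * (1 + r)) *\<^sub>R (\<nu> l - q k)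
     - (\<beta> * r) *\<^sub>R (n - \<nu> k - \<nu> l - (K - 2) *\<^sub>R q k)"
  define v where "v = (\<alpha> * (1 - r)) *\<^sub>R (\<nu> l - q l) - (\<beta> * (1 + r)) *\<^sub>R (\<nu> k - q l)
     - (\<beta> * r) *\<^sub>R (n - \<nu> l - \<nu> k - (K - 2) *\<^sub>R q l)"
  have "u - v = L *\<^sub>R (\<nu> k - \<nu> l)"
    by (simp add: u_def v_def ql vec_eq_iff L_def power2_eq_square algebra_simps)
  then show ?thesis
    unfolding matrix_vector_mult_diff_swap[of "E_LSE l" "\<nu> k" "\<nu> l"] E_LSE_mult[OF assms] E_LSE_mult[OF assms[symmetric]]
      n_def[symmetric] u_def[symmetric] v_def[symmetric]
    by (simp add: scaleR_right_diff_distrib[symmetric])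
qed

text \<open>A positive multiple of \<open>L\<close> is the value of a positive definite form at a
  nonzero vector.\<close>

lemma L_pos: "k \<noteq> (l::'k) \<Longrightarrow> 0 < L"
proof -
  assume "k \<noteq> l"
  then have "0 < (a - b)\<^sup>2 * K\<^sup>2 / \<sigma> ^ 3 * L"
    using pos_def_pos[OF pos_def_E_LSE, of "\<nu> k - \<nu> l" k] diff_inner_self[of k l] b_less_a
    by (cases "\<nu> k = \<nu> l") (auto simp: E_LSE_quad)
  moreover have "0 < (a - b)\<^sup>2 * K\<^sup>2 / \<sigma> ^ 3"
    using constants_pos(1) b_less_a K_ge_1 by simp
  ultimately show ?thesis
    by (rule zero_less_mult_pos)
qed

section \<open>Values of the two suprema and their ratio\<close>

lemma SUP_ASE:
  assumes "k \<noteq> l"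
  shows "(SUP t\<in>{0<..<1}. t * (1 - t) * sq_norm_wrt (matrix_inv
            (t *\<^sub>R Sigma_ASE (map_pmf \<nu> p) (\<nu> k) + (1 - t) *\<^sub>R Sigma_ASE (map_pmf \<nu> p) (\<nu> l)))
            (\<nu> k - \<nu> l)) = (a - b)\<^sup>2 / (K * (\<alpha> + \<beta>))" (is "?S = _")
proof -
  let ?y = "\<nu> k - \<nu> l"
  have y: "E_ASE k *v ?y + E_ASE l *v ?y = ((a - b) * (\<alpha> + \<beta>) / K) *\<^sub>R ?y"
    unfolding matrix_vector_mult_diff_swap[of "E_ASE l" "\<nu> k" "\<nu> l"] E_ASE_mult[OF assms] E_ASE_mult[OF assms[symmetric]]
    by (simp add: vec_eq_iff algebra_simps add_divide_distrib diff_divide_distrib)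
  have quad: "(\<nu> k - \<nu> l) \<bullet> (E_ASE k *v (\<nu> k - \<nu> l)) = (a - b)\<^sup>2 * (\<alpha> + \<beta>) / K" if "k \<noteq> l" for k l
  proof -
    let ?y = "\<nu> k - \<nu> l"
    have ip: "?y \<bullet> \<nu> k = a - b" "?y \<bullet> \<nu> l = - (a - b)"
      using that by (simp_all add: inner_commute[of ?y] inner_diff)
    show ?thesis
      unfolding E_ASE_mult[OF that] inner_scaleR_right inner_diff_right[of ?y] ip
      by (simp add: power2_eq_square field_simps)
  qed
  \<comment> \<open>Here \<gamma> is 1, \<theta> is the eigenvalue \<open>(a - b) / K\<close> of
    \<open>Delta\<close>, and \<open>e\<close> is read off from \<open>y\<close>.\<close>
  have "?S = 1\<^sup>2 * ((1 / K) * (a - b))\<^sup>2 * (?y \<bullet> ?y) / (2 * ((a - b) * (\<alpha> + \<beta>) / K))"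
    unfolding Sigma_ASE_eq
    using K_ge_1 b_less_a constants_pos quad[OF assms] quad[OF assms[symmetric]]
    by (subst SUP_chernoff_sandwich[where \<gamma> = 1, simplified scaleR_one, OF pos_def_T pos_def_E_ASE
          pos_def_E_ASE T_eigen y]) (auto simp: matrix_vector_mult_diff_swap[of "E_ASE l" "\<nu> k" "\<nu> l"] inner_diff_left)
  also have "\<dots> = (a - b)\<^sup>2 / (K * (\<alpha> + \<beta>))"
    unfolding diff_inner_self[OF assms] using b_less_a constants_pos(2,3) K_ge_1
    by (simp add: divide_simps power2_eq_square) (simp add: algebra_simps)
  finally show ?thesis .
qed

lemma SUP_LSE:
  assumes "k \<noteq> l"
  shows "(SUP t\<in>{0<..<1}. t * (1 - t) * sq_norm_wrt (matrix_inv
            (t *\<^sub>R Sigma_LSE (map_pmf \<nu> p) (\<nu> k) + (1 - t) *\<^sub>R Sigma_LSE (map_pmf \<nu> p) (\<nu> l)))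
            ((1 / sqrt (\<sigma> / K)) *\<^sub>R \<nu> k - (1 / sqrt (\<sigma> / K)) *\<^sub>R \<nu> l)) = (a - b)\<^sup>2 / (K * L)" (is "?S = _")
proof -
  let ?y = "\<nu> k - \<nu> l"
  have L: "0 < L" by (rule L_pos[OF assms])
  \<comment> \<open>Here \<gamma> is the common scale of the normalised positions and \<theta> is
    the eigenvalue \<open>(a - b) / \<sigma>\<close> of \<open>Delta_tilde\<close>.\<close>
  have "?S = (1 / sqrt (\<sigma> / K))\<^sup>2 * ((1 / \<sigma>) * (a - b))\<^sup>2 * (?y \<bullet> ?y) / (2 * ((a - b) * K\<^sup>2 / \<sigma> ^ 3 * L))"
    unfolding Sigma_LSE_eq scaleR_right_diff_distrib[symmetric]
    using K_ge_1 b_less_a constants_pos L E_LSE_quad[OF assms] E_LSE_quad[OF assms[symmetric]]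
    by (subst SUP_chernoff_sandwich[OF pos_def_T pos_def_E_LSE
          pos_def_E_LSE T_eigen E_LSE_eigen[OF assms]]) (auto simp: matrix_vector_mult_diff_swap[of "E_LSE l" "\<nu> k" "\<nu> l"] inner_diff_left)
  also have "(1 / sqrt (\<sigma> / K))\<^sup>2 = K / \<sigma>"
    using constants_pos(1) K_ge_1 by (simp add: power_divide)
  also have "K / \<sigma> * ((1 / \<sigma>) * (a - b))\<^sup>2 * (?y \<bullet> ?y) / (2 * ((a - b) * K\<^sup>2 / \<sigma> ^ 3 * L)) = (a - b)\<^sup>2 / (K * L)"
    unfolding diff_inner_self[OF assms] using b_less_a constants_pos(1) K_ge_1 L
    by (simp add: divide_simps power2_eq_square power3_eq_cube)
  finally show ?thesis .
qed

text \<open>In the expansion of \<open>L\<close> in powers of \<open>r\<close>, the linear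
  coefficient contains \<open>\<alpha> - \<beta>\<close>, a multiple of
  \<open>a - b = 2 * r * \<sigma>\<close>. So everything beyond \<open>\<alpha> + \<beta>\<close>
  carries the factor \<open>r\<^sup>2\<close>.\<close>

lemma L_ratio:
  "L / (\<alpha> + \<beta>) = 1 + ((a - b)\<^sup>2 * (3 * a * (a - 1) + 3 * b * (b - 1) * (K - 1) + 4 * a * b * K))
     / (4 * (a + (K - 1) * b)\<^sup>2 * (a * (1 - a) + b * (1 - b)))"
proof -
  have s: "0 < \<alpha> + \<beta>" using constants_pos by simp
  have ab: "a - b = 2 * r * \<sigma>"
    using constants_pos(1) by (simp add: r_def)
  have "\<alpha> - \<beta> = (a - b) * (1 - a - b)"
    unfolding \<alpha>_def \<beta>_def by (simp add: algebra_simps)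
  then have diff: "\<alpha> - \<beta> = 2 * r * \<sigma> * (1 - a - b)"
    unfolding ab .
  have "L = (\<alpha> + \<beta>) - 2 * r * (\<alpha> - \<beta>) + r\<^sup>2 * (\<alpha> + (K - 1) * \<beta>)"
    unfolding L_def power2_eq_square by (simp add: algebra_simps)
  also have "\<dots> = (\<alpha> + \<beta>) + r\<^sup>2 * (\<alpha> + (K - 1) * \<beta> - 4 * \<sigma> * (1 - a - b))"
    unfolding diff power2_eq_square by (simp add: algebra_simps)
  also have "r\<^sup>2 = (a - b)\<^sup>2 / (4 * \<sigma>\<^sup>2)"
    by (simp add: r_def power_divide power_mult_distrib)
  also have "\<alpha> + (K - 1) * \<beta> - 4 * \<sigma> * (1 - a - b) = 3 * a * (a - 1) + 3 * b * (b - 1) * (K - 1) + 4 * a * b * K"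
    unfolding \<alpha>_def \<beta>_def \<sigma>_def by (simp add: algebra_simps)
  finally show ?thesis
    using s unfolding \<alpha>_def[symmetric] \<beta>_def[symmetric] \<sigma>_def[symmetric] by (simp add: add_divide_distrib)
qed

end

section \<open>The minimum over pairs and the final formula\<close>

lemma ex_distinct:
  assumes "2 \<le> CARD('k::finite)"
  shows "\<exists>k l::'k. k \<noteq> l"
  using assms by (metis card_2_iff' card_le_Suc0_iff_eq finite not_less_eq_eq numeral_2_eq_2 UNIV_I)

lemma min_chernoff_const:
  fixes m :: "'k::finite \<Rightarrow> 'n::finite rvec"
  assumes "2 \<le> CARD('k)"
    and "\<And>k l. k \<noteq> l \<Longrightarrow> (SUP t\<in>{0<..<1}.
            t * (1 - t) * sq_norm_wrt (matrix_inv (t *\<^sub>R S k + (1 - t) *\<^sub>R S l)) (m k - m l)) = c"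
  shows "min_chernoff m S = c"
proof -
  obtain k l :: 'k where "k \<noteq> l"
    using ex_distinct[OF assms(1)] by blast
  then have "{SUP t\<in>{0<..<1}.
            t * (1 - t) * sq_norm_wrt (matrix_inv (t *\<^sub>R S k + (1 - t) *\<^sub>R S l)) (m k - m l)
          | k l. k \<noteq> l} = {c}"
    using assms(2) by auto
  then show ?thesis by (simp add: min_chernoff_def)
qed

theorem theorem6:
  fixes a b :: real
    and K :: nat
    and B :: "('k::{finite,linorder}) sqmat"
    and \<pi> :: "'k pmf"
  assumes "K = CARD('k)" and "K \<ge> 2"
    and "0 < b" and "b < a" and "a < 1"
    and "B = (\<chi> i j. if i = j then a else b)"
    and "\<And>k. pmf \<pi> k = 1 / real K"
  shows "rho_star B \<pi> =
           1 + ((a - b)\<^sup>2 * (3 * a * (a - 1) + 3 * b * (b - 1) * (real K - 1) + 4 * a * b * real K))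
               / (4 * (a + (real K - 1) * b)\<^sup>2 * (a * (1 - a) + b * (1 - b)))
       \<and> rho_star B \<pi> = 1 + c_abK a b K * psi_abK a b K
       \<and> c_abK a b K > 0"
proof -
  interpret two_valued_gram "latent_pos B" \<pi> a b "real K"
    using assms ex_cholesky_factor_two_valued[of b a, where 'k='k] latent_pos_inner[of B]
    by unfold_locales auto
  have card: "2 \<le> CARD('k)" using assms by simp
  then obtain k l :: 'k where kl: "k \<noteq> l"
    using ex_distinct by blast
  \<comment> \<open>The normalising sums are row sums of \<open>B\<close> divided by
    \<open>K\<close>, hence equal for all blocks.\<close>
  have tilde: "latent_pos_tilde B \<pi> k = (1 / sqrt (\<sigma> / real K)) *\<^sub>R latent_pos B k" for k
    using sum_inner[of k]
    by (simp add: latent_pos_tilde_def unif sum_divide_distrib[symmetric] inner_sum_left)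
  have "rho_star B \<pi> = ((a - b)\<^sup>2 / (real K * (\<alpha> + \<beta>))) / ((a - b)\<^sup>2 / (real K * L))"
    unfolding rho_star_def latent_pmf_def
    by (intro arg_cong2[where f = "(/)"] min_chernoff_const[OF card])
      (simp add: SUP_ASE, unfold tilde, rule SUP_LSE)
  also have "\<dots> = L / (\<alpha> + \<beta>)"
    using K_ge_1 assms(2,4) L_pos[OF kl] constants_pos by (simp add: divide_simps)
  finally have rho: "rho_star B \<pi> = L / (\<alpha> + \<beta>)" .
  have "c_abK a b K > 0"
    using assms(4) constants_pos unfolding c_abK_def \<sigma>_def \<alpha>_def \<beta>_def by simp
  then show ?thesis
    unfolding rho L_ratio by (simp add: c_abK_def psi_abK_def)
qed

end
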